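(* Consider any allocation process satisfying $\mathcal{P}_1$ and $\mathcal{W}_1$. Then, for any round $t\ge0$, $$\mathbb{E}\big[\Upsilon^{t+1}\,\big|\,\mathfrak{F}^t\big]\le\Upsilon^t+\sum_{i\in B_+^t}2y_i^tp_i^t\cdot w_++\sum_{i\in B_-^t}2y_i^tp_i^t\cdot w_-+4\cdot(w_-)^2.$$ Hence, for any process satisfying both $\mathcal{P}_2$ and $\mathcal{W}_1$, or both $\mathcal{P}_1$ and $\mathcal{W}_2$, there exist constants $c_1,c_2>0$ such that for any round $t\ge0$, $$\mathbb{E}\big[\Upsilon^{t+1}\,\big|\,\mathfrak{F}^t\big]\le\Upsilon^t-\frac{c_1}{n}\cdot\Delta^t+c_2.$$
   Context: Allocation processes. For each $n$, balls are sequentially allocated into $n$ bins. $x^t\in\mathbb{Z}_{\ge0}^n$ is the load vector after $t$ allocations (round $t=0,1,2,\dots$), with $x^0=(0,\dots,0)$. In the $(t+1)$-th allocation exactly one bin is chosen and it receives one or more balls. $W^t=\sum_ix_i^t$ and $y_i^t=x_i^t-W^t/n$. $\mathfrak{F}^t$ is the filtration of the first $t$ allocations. At each round $t$ bins are relabelled so that $x_1^t\ge\dots\ge x_n^t$, and $p_i^t$ (which may depend on $\mathfrak F^t$) is the conditional probability, given $\mathfrak{F}^t$, that the bin chosen in the $(t+1)$-th allocation is the $i$-th heaviest. $B_+^t=\{i:y_i^t\ge0\}$, $B_-^t=[n]\setminus B_+^t$, $\delta^t=|B_+^t|/n$, $P_-^t=\sum_{i\in B_-^t}p_i^t$. Potentials: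 $\Delta^t=\sum_{i=1}^n|y_i^t|$ and $\Upsilon^t=\sum_{i=1}^n(y_i^t)^2$. For vectors of equal length, $p\succeq q$ (equivalently $q\preceq p$) means $\sum_{i=1}^kp_i\ge\sum_{i=1}^kq_i$ for every $k$. Conditions on an empty set of bins are vacuous. "Constant" means independent of $t$ and $n$. Condition $\mathcal{P}_1$: there are an integer constant $k_1\ge1$ and a constant $k_2\in(0,1]$ such that for each round $t\ge0$: $\max_{i\in B_+^t}p_i^t\le k_1/n$ and $(p_1^t,\dots,p_{\delta^tn}^t)\preceq(\frac1n,\dots,\frac1n)$; and $\min_{i\in B_-^t}p_i^t\ge k_2/n$ and $(p_n^t,p_{n-1}^t,\dots,p_{\delta^tn+1}^t)\succeq(\frac1n,\dots,\frac1n)$. Condition $\mathcal{P}_2$: there are an integer constant $k_1\ge1$ and constants $k_2,k_3,k_4\in(0,1]$ such that for each round $t\ge0$: $\max_{i\in B_+^t}p_i^t\le k_1/n$ and $(p_1^t,\dots,p_{\delta^tn}^t)\preceq(\frac1n-\frac{k_3(1-\delta^t)}{n},\dots,\frac1n-\frac{k_3(1-\delta^t)}{n})$; and $\min_{i\in B_-^t}p_i^t\ge k_2/n$ and $(p_n^t,\dots,p_{\delta^tn+1}^t)\succeq(\frac1n+\frac{k_4\delta^t}{n},\dots,\frac1n+\frac{k_4\delta^t}{n})$. Condition $\mathcal{W}_1$: for each round $t\ge0$, when bin $i$ is chosen for allocation, $w_-$ balls are allocated to $i$ if $y_i^t<0$ and $w_+$ balls if $y_i^t\ge0$, where $1\le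 w_+\le w_-$ are constant integers. Condition $\mathcal{W}_2$: as $\mathcal{W}_1$, but with $w_+<w_-$, and additionally for each round $t\ge0$, $(p_n^t,\dots,p_{\delta^tn+1}^t)\succeq(\frac{P_-^t}{|B_-^t|},\dots,\frac{P_-^t}{|B_-^t|})$. *)

theory Defs
  imports "HOL-Probability.Probability"
begin

text \<open>
  An allocation process with \<open>n\<close> bins. The physical bins are \<open>{1..n}\<close>. Allocations are numbered from
  \<open>0\<close>, so that \<open>chosen A t\<close> and \<open>balls A t\<close> are the bin chosen in the \<open>(t+1)\<close>-th allocation and the
  number of balls it receives. \<open>relabel A t \<omega> i\<close> is the physical bin that carries the label \<open>i\<close>
  (the \<open>i\<close>-th heaviest bin) at round \<open>t\<close>; ties may be broken in any way, even at random.
\<close>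

record 'a alloc_process =
  pspace  :: "'a measure"
  chosen  :: "nat \<Rightarrow> 'a \<Rightarrow> nat"
  balls   :: "nat \<Rightarrow> 'a \<Rightarrow> nat"
  relabel :: "nat \<Rightarrow> 'a \<Rightarrow> nat \<Rightarrow> nat"

definition bin_load :: "'a alloc_process \<Rightarrow> nat \<Rightarrow> 'a \<Rightarrow> nat \<Rightarrow> nat" where
  "bin_load A t \<omega> j = (\<Sum>s<t. if chosen A s \<omega> = j then balls A s \<omega> else 0)"

text \<open>\<open>x\<^sub>i\<^sup>t\<close>, with \<open>i\<close> the label at round \<open>t\<close>.\<close>

definition load :: "'a alloc_process \<Rightarrow> nat \<Rightarrow> 'a \<Rightarrow> nat \<Rightarrow> nat" where
  "load A t \<omega> i = bin_load A t \<omega> (relabel A t \<omega> i)"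

definition allocation_process :: "nat \<Rightarrow> 'a alloc_process \<Rightarrow> bool" where
  "allocation_process n A \<longleftrightarrow>
     prob_space (pspace A) \<and>
     (\<forall>t. chosen A t \<in> pspace A \<rightarrow>\<^sub>M count_space {1..n}) \<and>
     (\<forall>t. balls A t \<in> pspace A \<rightarrow>\<^sub>M count_space {1..}) \<and>
     (\<forall>t. \<forall>i\<in>{1..n}. (\<lambda>\<omega>. relabel A t \<omega> i) \<in> pspace A \<rightarrow>\<^sub>M count_space {1..n}) \<and>
     (\<forall>t. \<forall>\<omega>\<in>space (pspace A).
        bij_betw (relabel A t \<omega>) {1..n} {1..n} \<and> antimono_on {1..n} (load A t \<omega>))"

text \<open>The \<open>\<sigma>\<close>-algebra generated by the first \<open>t\<close> allocations, which form a random element of the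
  countable set of lists of pairs (bin, number of balls).\<close>

definition filt :: "'a alloc_process \<Rightarrow> nat \<Rightarrow> 'a measure" where
  "filt A t = vimage_algebra (space (pspace A))
     (\<lambda>\<omega>. map (\<lambda>s. (chosen A s \<omega>, balls A s \<omega>)) [0..<t]) (count_space UNIV)"

definition total_load :: "nat \<Rightarrow> 'a alloc_process \<Rightarrow> nat \<Rightarrow> 'a \<Rightarrow> nat" where
  "total_load n A t \<omega> = (\<Sum>i\<in>{1..n}. load A t \<omega> i)"

text \<open>\<open>y\<^sub>i\<^sup>t\<close>\<close>

definition nload :: "nat \<Rightarrow> 'a alloc_process \<Rightarrow> nat \<Rightarrow> 'a \<Rightarrow> nat \<Rightarrow> real" where
  "nload n A t \<omega> i = real (load A t \<omega> i) - real (total_load n A t \<omega>) / real n"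

text \<open>\<open>p\<^sub>i\<^sup>t\<close>, as an \<open>\<omega>\<close>-indexed vector; like every conditional probability it is determined only
  almost surely.\<close>

definition alloc_prob :: "'a alloc_process \<Rightarrow> nat \<Rightarrow> 'a \<Rightarrow> nat \<Rightarrow> real" where
  "alloc_prob A t \<omega> i = real_cond_exp (pspace A) (filt A t)
     (indicat_real {\<omega>' \<in> space (pspace A). chosen A t \<omega>' = relabel A t \<omega>' i}) \<omega>"

definition B_plus :: "nat \<Rightarrow> 'a alloc_process \<Rightarrow> nat \<Rightarrow> 'a \<Rightarrow> nat set" where
  "B_plus n A t \<omega> = {i \<in> {1..n}. nload n A t \<omega> i \<ge> 0}"

definition B_minus :: "nat \<Rightarrow> 'a alloc_process \<Rightarrow> nat \<Rightarrow> 'a \<Rightarrow> nat set" where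
  "B_minus n A t \<omega> = {1..n} - B_plus n A t \<omega>"

definition quant :: "nat \<Rightarrow> 'a alloc_process \<Rightarrow> nat \<Rightarrow> 'a \<Rightarrow> real" where
  "quant n A t \<omega> = real (card (B_plus n A t \<omega>)) / real n"

definition P_minus :: "nat \<Rightarrow> 'a alloc_process \<Rightarrow> nat \<Rightarrow> 'a \<Rightarrow> real" where
  "P_minus n A t \<omega> = (\<Sum>i\<in>B_minus n A t \<omega>. alloc_prob A t \<omega> i)"

definition abs_potential :: "nat \<Rightarrow> 'a alloc_process \<Rightarrow> nat \<Rightarrow> 'a \<Rightarrow> real" where
  "abs_potential n A t \<omega> = (\<Sum>i\<in>{1..n}. \<bar>nload n A t \<omega> i\<bar>)"

definition quad_potential :: "nat \<Rightarrow> 'a alloc_process \<Rightarrow> nat \<Rightarrow> 'a \<Rightarrow> real" where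
  "quad_potential n A t \<omega> = (\<Sum>i\<in>{1..n}. (nload n A t \<omega> i)\<^sup>2)"

text \<open>Only prefix sums are compared; neither sorting nor equality of the full sums is required.\<close>

definition prefix_dominates :: "real list \<Rightarrow> real list \<Rightarrow> bool" where
  "prefix_dominates p q \<longleftrightarrow> length p = length q \<and>
     (\<forall>k\<in>{1..length p}. (\<Sum>i<k. p ! i) \<ge> (\<Sum>i<k. q ! i))"

text \<open>The vectors \<open>(p\<^sub>1, \<dots>, p\<^bsub>\<delta>n\<^esub>)\<close> and \<open>(p\<^sub>n, p\<^bsub>n-1\<^esub>, \<dots>, p\<^bsub>\<delta>n+1\<^esub>)\<close>, where \<open>\<delta>n\<close> is the
  cardinality of \<open>B_plus\<close>.\<close>

definition probs_plus :: "nat \<Rightarrow> 'a alloc_process \<Rightarrow> nat \<Rightarrow> 'a \<Rightarrow> real list" where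
  "probs_plus n A t \<omega> = map (alloc_prob A t \<omega>) [1..<card (B_plus n A t \<omega>) + 1]"

definition probs_minus :: "nat \<Rightarrow> 'a alloc_process \<Rightarrow> nat \<Rightarrow> 'a \<Rightarrow> real list" where
  "probs_minus n A t \<omega> = map (alloc_prob A t \<omega>) (rev [card (B_plus n A t \<omega>) + 1..<n + 1])"

text \<open>The conditions concern a process given for every number \<open>n \<ge> 1\<close> of bins; their constants do
  not depend on \<open>n\<close> or \<open>t\<close>.\<close>

definition cond_P1 :: "(nat \<Rightarrow> 'a alloc_process) \<Rightarrow> bool" where
  "cond_P1 A \<longleftrightarrow> (\<exists>(k1::nat) (k2::real). k1 \<ge> 1 \<and> k2 \<in> {0<..1} \<and>
     (\<forall>n\<ge>1. \<forall>t. AE \<omega> in pspace (A n).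
        (\<forall>i\<in>B_plus n (A n) t \<omega>. alloc_prob (A n) t \<omega> i \<le> real k1 / real n) \<and>
        prefix_dominates (replicate (card (B_plus n (A n) t \<omega>)) (1 / real n))
          (probs_plus n (A n) t \<omega>) \<and>
        (\<forall>i\<in>B_minus n (A n) t \<omega>. alloc_prob (A n) t \<omega> i \<ge> k2 / real n) \<and>
        prefix_dominates (probs_minus n (A n) t \<omega>)
          (replicate (card (B_minus n (A n) t \<omega>)) (1 / real n))))"

definition cond_P2 :: "(nat \<Rightarrow> 'a alloc_process) \<Rightarrow> bool" where
  "cond_P2 A \<longleftrightarrow> (\<exists>(k1::nat) (k2::real) (k3::real) (k4::real).
     k1 \<ge> 1 \<and> k2 \<in> {0<..1} \<and> k3 \<in> {0<..1} \<and> k4 \<in> {0<..1} \<and>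
     (\<forall>n\<ge>1. \<forall>t. AE \<omega> in pspace (A n).
        (\<forall>i\<in>B_plus n (A n) t \<omega>. alloc_prob (A n) t \<omega> i \<le> real k1 / real n) \<and>
        prefix_dominates
          (replicate (card (B_plus n (A n) t \<omega>))
             (1 / real n - k3 * (1 - quant n (A n) t \<omega>) / real n))
          (probs_plus n (A n) t \<omega>) \<and>
        (\<forall>i\<in>B_minus n (A n) t \<omega>. alloc_prob (A n) t \<omega> i \<ge> k2 / real n) \<and>
        prefix_dominates (probs_minus n (A n) t \<omega>)
          (replicate (card (B_minus n (A n) t \<omega>))
             (1 / real n + k4 * quant n (A n) t \<omega> / real n))))"

definition cond_W1 :: "nat \<Rightarrow> nat \<Rightarrow> (nat \<Rightarrow> 'a alloc_process) \<Rightarrow> bool" where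
  "cond_W1 w_plus w_minus A \<longleftrightarrow> 1 \<le> w_plus \<and> w_plus \<le> w_minus \<and>
     (\<forall>n\<ge>1. \<forall>t. AE \<omega> in pspace (A n). \<forall>i\<in>{1..n}.
        chosen (A n) t \<omega> = relabel (A n) t \<omega> i \<longrightarrow>
          balls (A n) t \<omega> = (if nload n (A n) t \<omega> i < 0 then w_minus else w_plus))"

definition cond_W2 :: "nat \<Rightarrow> nat \<Rightarrow> (nat \<Rightarrow> 'a alloc_process) \<Rightarrow> bool" where
  "cond_W2 w_plus w_minus A \<longleftrightarrow> cond_W1 w_plus w_minus A \<and> w_plus < w_minus \<and>
     (\<forall>n\<ge>1. \<forall>t. AE \<omega> in pspace (A n).
        prefix_dominates (probs_minus n (A n) t \<omega>)
          (replicate (card (B_minus n (A n) t \<omega>))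
             (P_minus n (A n) t \<omega> / real (card (B_minus n (A n) t \<omega>)))))"

end

theory Submission
  imports Defs
begin

text \<open>
  If bin \<open>c\<close> receives \<open>b\<close> balls then, because the normalized loads sum to zero, the quadratic
  potential grows by exactly \<open>2 b y\<^sub>c + b\<^sup>2 (1 - 1/n)\<close>. The sorted loads \<open>y\<^sub>i\<close> are functions of the
  history even if ties are broken by external randomness, so they can be pulled out of the
  conditional expectation; this gives the first bound. For the second one, \<open>y\<close> is monotone on
  \<open>B\<^sub>+\<close> and on \<open>B\<^sub>-\<close>, so summation by parts lets us replace \<open>p\<^sub>i\<close> by the constants of the
  majorization conditions, and each of the two sides contributes one half of \<open>\<Delta>\<close>.
\<close>

section \<open>Summation by parts against monotone weights\<close>

text \<open>Abel summation: all prefix sums of \<open>d\<close> are nonpositive, so replacing a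
  weight by a smaller one can only raise the product of that weight with a prefix sum. The final
  product is nonpositive because the last weight is nonnegative.\<close>

lemma sum_mult_antimono_nonpos:
  fixes y d :: "nat \<Rightarrow> real"
  assumes "\<And>i j. i \<le> j \<Longrightarrow> j < m \<Longrightarrow> y j \<le> y i"
    and "\<And>i. i < m \<Longrightarrow> 0 \<le> y i"
    and "\<And>k. k \<le> m \<Longrightarrow> (\<Sum>i<k. d i) \<le> 0"
  shows "(\<Sum>i<m. y i * d i) \<le> 0"
proof -
  \<comment> \<open>The claim is strengthened to keep the last weight times the prefix sum, which is
    what the induction can carry. At \<open>k = 0\<close> both sums are empty, so the truncated
    index \<open>k - 1\<close> is harmless.\<close>
  have "(\<Sum>i<k. y i * d i) \<le> y (k - 1) * (\<Sum>i<k. d i)" if "k \<le> m" for k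
    using that
  proof (induction k)
    case (Suc k)
    have "y (k - 1) * (\<Sum>i<k. d i) \<le> y k * (\<Sum>i<k. d i)"
      using assms(1)[of "k - 1" k] assms(3)[of k] Suc.prems
      by (intro mult_right_mono_neg) auto
    with Suc show ?case by (simp add: algebra_simps)
  qed simp
  from this[of m] have le: "(\<Sum>i<m. y i * d i) \<le> y (m - 1) * (\<Sum>i<m. d i)" by simp
  show ?thesis
  proof (cases m)
    case (Suc k)
    then have "y (m - 1) * (\<Sum>i<m. d i) \<le> 0"
      using assms(2)[of "m - 1"] assms(3)[of m] by (intro mult_nonneg_nonpos) auto
    with le show ?thesis by simp
  qed simp
qed

text \<open>Summation by parts is applied to the differences \<open>q ! i - p ! i\<close>. Since
  \<open>prefix_dominates\<close> does not force equal totals, monotone weights alone would leave a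
  last term of unknown sign; nonnegativity of \<open>y\<close> settles it.\<close>

lemma prefix_dominates_weighted_sum:
  assumes "prefix_dominates p q"
    and "\<And>i j. i \<le> j \<Longrightarrow> j < length p \<Longrightarrow> y j \<le> y i"
    and "\<And>i. i < length p \<Longrightarrow> 0 \<le> y i"
  shows "(\<Sum>i<length p. y i * q ! i) \<le> (\<Sum>i<length p. y i * p ! i)"
proof -
  have "(\<Sum>i<k. q ! i - p ! i) \<le> 0" if "k \<le> length p" for k
    using assms(1) that by (cases "k = 0") (auto simp: prefix_dominates_def sum_subtractf)
  then have "(\<Sum>i<length p. y i * (q ! i - p ! i)) \<le> 0"
    using assms(2,3) by (intro sum_mult_antimono_nonpos) auto
  then show ?thesis by (simp add: right_diff_distrib sum_subtractf)
qed

section \<open>Initial segments and the increment of a sum of squares\<close>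

lemma down_closed_eq_atLeastAtMost_card:
  assumes "B \<subseteq> {1..n::nat}" and "\<And>i j. j \<in> B \<Longrightarrow> 1 \<le> i \<Longrightarrow> i \<le> j \<Longrightarrow> i \<in> B"
  shows "B = {1..card B}"
proof (cases "B = {}")
  case False
  have fin: "finite B" using assms(1) finite_subset by blast
  have "B = {1..Max B}"
  proof
    show "B \<subseteq> {1..Max B}" using assms(1) Max_ge[OF fin] by auto
    show "{1..Max B} \<subseteq> B" using assms(2)[OF Max_in[OF fin False]] by auto
  qed
  then have "card B = Max B" by (metis card_atLeastAtMost diff_Suc_1)
  with \<open>B = {1..Max B}\<close> show ?thesis by simp
qed simp

text \<open>With \<open>N = card S\<close>, the common shift \<open>b / N\<close> meets
  \<open>z\<close> only through the sum of \<open>z\<close>, which is zero. What remains of the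
  shift is \<open>- 2 * b\<^sup>2 / N\<close> from index \<open>c\<close> and
  \<open>N * (b\<^sup>2 / N\<^sup>2)\<close> from its squares, together
  \<open>- b\<^sup>2 / N\<close>.\<close>

lemma sum_sq_increment:
  fixes z :: "'b \<Rightarrow> real"
  assumes "finite S" "c \<in> S" "(\<Sum>j\<in>S. z j) = 0"
  shows "(\<Sum>j\<in>S. (z j + (if c = j then b else 0) - b / card S)\<^sup>2)
       = (\<Sum>j\<in>S. (z j)\<^sup>2) + 2 * b * z c + b\<^sup>2 * (1 - 1 / card S)"
proof -
  define N where "N = real (card S)"
  have N: "N > 0" using assms unfolding N_def by (auto simp: card_gt_0_iff)
  have "(\<Sum>j\<in>S. (z j + (if c = j then b else 0) - b / N)\<^sup>2)
      = (\<Sum>j\<in>S. (z j)\<^sup>2 + (if c = j then 2 * z c * b + b\<^sup>2 - 2 * b\<^sup>2 / N else 0)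
            - 2 * b / N * z j + b\<^sup>2 / N\<^sup>2)"
    by (rule sum.cong)
       (auto simp: power2_eq_square algebra_simps add_divide_distrib diff_divide_distrib)
  also have "\<dots> = (\<Sum>j\<in>S. (z j)\<^sup>2) + (2 * z c * b + b\<^sup>2 - 2 * b\<^sup>2 / N) + N * (b\<^sup>2 / N\<^sup>2)"
  proof -
    have "(\<Sum>j\<in>S. 2 * b / N * z j) = 0"
      by (simp only: sum_distrib_left[symmetric] assms(3) mult_zero_right)
    then show ?thesis using assms(1,2) by (simp add: sum.distrib sum_subtractf N_def)
  qed
  also have "\<dots> = (\<Sum>j\<in>S. (z j)\<^sup>2) + 2 * b * z c + b\<^sup>2 * (1 - 1 / N)"
    using N by (simp add: power2_eq_square field_simps)
  finally show ?thesis unfolding N_def .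
qed

lemma measurable_count_space_UNIV:
  "f \<in> M \<rightarrow>\<^sub>M count_space S \<Longrightarrow> f \<in> M \<rightarrow>\<^sub>M count_space UNIV"
  using measurable_compose[of f M "count_space S" "\<lambda>x. x" "count_space UNIV"] by simp

lemma bin_load_Suc:
  "bin_load A (Suc t) \<omega> j = bin_load A t \<omega> j + (if chosen A t \<omega> = j then balls A t \<omega> else 0)"
  by (simp add: bin_load_def)

section \<open>Loads and potentials along a single outcome\<close>

context
  fixes n :: nat and A :: "'a alloc_process"
  assumes n: "n \<ge> 1" and alloc: "allocation_process n A"
begin

lemma chosen_in: "\<omega> \<in> space (pspace A) \<Longrightarrow> chosen A t \<omega> \<in> {1..n}"
  using alloc unfolding allocation_process_def by (metis measurable_space space_count_space)

lemma relabel_bij: "\<omega> \<in> space (pspace A) \<Longrightarrow> bij_betw (relabel A t \<omega>) {1..n} {1..n}"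
  using alloc unfolding allocation_process_def by blast

lemma load_antimono: "\<omega> \<in> space (pspace A) \<Longrightarrow> antimono_on {1..n} (load A t \<omega>)"
  using alloc unfolding allocation_process_def by blast

lemma nload_antimono:
  assumes "\<omega> \<in> space (pspace A)" "1 \<le> i" "i \<le> j" "j \<le> n"
  shows "nload n A t \<omega> j \<le> nload n A t \<omega> i"
  using monotone_onD[OF load_antimono[OF assms(1), of t], of i j] assms by (simp add: nload_def)

lemma total_load_eq_bin_loads:
  "\<omega> \<in> space (pspace A) \<Longrightarrow> total_load n A t \<omega> = (\<Sum>j\<in>{1..n}. bin_load A t \<omega> j)"
  unfolding total_load_def load_def by (intro sum.reindex_bij_betw relabel_bij)

text \<open>Every chosen bin lies in \<open>{1..n}\<close>, so after exchanging the sums each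
  allocation is counted exactly once. This yields both the change of the average load in one round
  and, later, an almost sure bound on all loads.\<close>

lemma total_load_eq_balls:
  assumes "\<omega> \<in> space (pspace A)"
  shows "total_load n A t \<omega> = (\<Sum>s<t. balls A s \<omega>)"
proof -
  have "total_load n A t \<omega> = (\<Sum>s<t. \<Sum>j\<in>{1..n}. if chosen A s \<omega> = j then balls A s \<omega> else 0)"
    unfolding total_load_eq_bin_loads[OF assms] bin_load_def by (rule sum.swap)
  also have "\<dots> = (\<Sum>s<t. balls A s \<omega>)"
    using chosen_in[OF assms] by (intro sum.cong) auto
  finally show ?thesis .
qed

lemma sum_nload: "(\<Sum>i\<in>{1..n}. nload n A t \<omega> i) = 0"
  using n by (simp add: nload_def sum_subtractf total_load_def)

text \<open>Both the load and the average load lie between zero and the total load.\<close>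

lemma abs_nload_le:
  assumes "i \<in> {1..n}"
  shows "\<bar>nload n A t \<omega> i\<bar> \<le> real (total_load n A t \<omega>)"
proof -
  have "load A t \<omega> i \<le> total_load n A t \<omega>"
    unfolding total_load_def using assms by (intro member_le_sum) auto
  moreover have "real (total_load n A t \<omega>) / real n \<le> real (total_load n A t \<omega>)"
    using n by (simp add: divide_le_eq mult_le_cancel_left1)
  moreover have "0 \<le> real (total_load n A t \<omega>) / real n" by simp
  ultimately show ?thesis unfolding nload_def by linarith
qed

text \<open>The labels may change from round \<open>t\<close> to round \<open>Suc t\<close>, so
  consecutive potentials are compared through the physical bins, where only one load
  changes.\<close>

lemma quad_potential_eq_bins:
  assumes "\<omega> \<in> space (pspace A)"
  shows "quad_potential n A t \<omega>
       = (\<Sum>j\<in>{1..n}. (real (bin_load A t \<omega> j) - real (total_load n A t \<omega>) / real n)\<^sup>2)"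
  unfolding quad_potential_def nload_def load_def
  by (rule sum.reindex_bij_betw[OF relabel_bij[OF assms]])

lemma quad_potential_Suc:
  assumes \<omega>: "\<omega> \<in> space (pspace A)" and c: "c \<in> {1..n}" "chosen A t \<omega> = relabel A t \<omega> c"
  shows "quad_potential n A (Suc t) \<omega>
       = quad_potential n A t \<omega> + 2 * real (balls A t \<omega>) * nload n A t \<omega> c
           + (real (balls A t \<omega>))\<^sup>2 * (1 - 1 / real n)"
proof -
  define b where "b = real (balls A t \<omega>)"
  define z where "z j = real (bin_load A t \<omega> j) - real (total_load n A t \<omega>) / real n" for j
  have "quad_potential n A (Suc t) \<omega>
      = (\<Sum>j\<in>{1..n}. (z j + (if chosen A t \<omega> = j then b else 0) - b / real (card {1..n}))\<^sup>2)"
    unfolding quad_potential_eq_bins[OF \<omega>]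
    by (rule sum.cong)
       (auto simp: z_def b_def bin_load_Suc total_load_eq_balls[OF \<omega>] add_divide_distrib
          algebra_simps)
  also have "\<dots> = (\<Sum>j\<in>{1..n}. (z j)\<^sup>2) + 2 * b * z (chosen A t \<omega>)
                    + b\<^sup>2 * (1 - 1 / real (card {1..n}))"
  proof (rule sum_sq_increment)
    show "(\<Sum>j\<in>{1..n}. z j) = 0"
      using n by (simp add: z_def sum_subtractf total_load_eq_bin_loads[OF \<omega>])
  qed (use chosen_in[OF \<omega>] in auto)
  finally show ?thesis
    by (simp add: quad_potential_eq_bins[OF \<omega>] z_def b_def c(2) nload_def load_def)
qed

section \<open>Overloaded and underloaded bins as intervals of labels\<close>

text \<open>The labels sort the loads, so the nonnegative ones come first. This aligns
  \<open>B_plus\<close> with the index range used in \<open>probs_plus\<close>.\<close>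

lemma B_plus_eq: "\<omega> \<in> space (pspace A) \<Longrightarrow> B_plus n A t \<omega> = {1..card (B_plus n A t \<omega>)}"
  by (rule down_closed_eq_atLeastAtMost_card[of _ n])
     (auto simp: B_plus_def intro: order.trans[OF _ nload_antimono])

lemma card_B_plus_le: "card (B_plus n A t \<omega>) \<le> n"
proof -
  have "card (B_plus n A t \<omega>) \<le> card {1..n}" by (intro card_mono) (auto simp: B_plus_def)
  then show ?thesis by simp
qed

lemma B_minus_eq: "\<omega> \<in> space (pspace A) \<Longrightarrow> B_minus n A t \<omega> = {card (B_plus n A t \<omega>) + 1..n}"
  unfolding B_minus_def by (subst B_plus_eq) auto

lemma card_B_minus: "card (B_minus n A t \<omega>) = n - card (B_plus n A t \<omega>)"
  unfolding B_minus_def by (subst card_Diff_subset) (auto simp: B_plus_def)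

lemma B_minus_neg: "i \<in> B_minus n A t \<omega> \<Longrightarrow> nload n A t \<omega> i < 0"
  by (auto simp: B_minus_def B_plus_def)

lemma sum_split_B:
  "(\<Sum>i\<in>{1..n}. f i) = (\<Sum>i\<in>B_plus n A t \<omega>. f i) + (\<Sum>i\<in>B_minus n A t \<omega>. f i)"
proof -
  have "B_plus n A t \<omega> \<subseteq> {1..n}" by (auto simp: B_plus_def)
  then show ?thesis unfolding B_minus_def
    by (subst sum.subset_diff[of "B_plus n A t \<omega>"]) (auto simp: add.commute)
qed

text \<open>The normalized loads sum to zero, so their positive and negative parts have the same
  absolute mass, half of \<open>abs_potential\<close> each.\<close>

lemma sum_B_plus: "(\<Sum>i\<in>B_plus n A t \<omega>. nload n A t \<omega> i) = abs_potential n A t \<omega> / 2"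
  and sum_B_minus: "(\<Sum>i\<in>B_minus n A t \<omega>. nload n A t \<omega> i) = - abs_potential n A t \<omega> / 2"
proof -
  have "abs_potential n A t \<omega>
      = (\<Sum>i\<in>B_plus n A t \<omega>. nload n A t \<omega> i) + (\<Sum>i\<in>B_minus n A t \<omega>. - nload n A t \<omega> i)"
    unfolding abs_potential_def
    by (subst sum_split_B[of _ t \<omega>], intro arg_cong2[where f = "(+)"] sum.cong)
       (auto simp: B_plus_def dest: B_minus_neg)
  moreover have "(\<Sum>i\<in>B_plus n A t \<omega>. nload n A t \<omega> i) + (\<Sum>i\<in>B_minus n A t \<omega>. nload n A t \<omega> i) = 0"
    using sum_nload[of t \<omega>] unfolding sum_split_B[of _ t \<omega>] .
  ultimately show "(\<Sum>i\<in>B_plus n A t \<omega>. nload n A t \<omega> i) = abs_potential n A t \<omega> / 2"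
    and "(\<Sum>i\<in>B_minus n A t \<omega>. nload n A t \<omega> i) = - abs_potential n A t \<omega> / 2"
    by (simp_all add: sum_negf)
qed

section \<open>Drift of each side under majorization\<close>

text \<open>On \<open>B_plus\<close> the normalized loads are nonnegative and decrease with the
  label, so they are admissible weights; against the constant vector they give \<open>c\<close>
  times half of \<open>abs_potential\<close>.\<close>

lemma B_plus_drift_le:
  assumes \<omega>: "\<omega> \<in> space (pspace A)"
    and dom: "prefix_dominates (replicate (card (B_plus n A t \<omega>)) c) (probs_plus n A t \<omega>)"
  shows "(\<Sum>i\<in>B_plus n A t \<omega>. nload n A t \<omega> i * alloc_prob A t \<omega> i)
       \<le> c * abs_potential n A t \<omega> / 2"
proof -
  define m where "m = card (B_plus n A t \<omega>)"
  have B: "B_plus n A t \<omega> = {1..m}" unfolding m_def by (rule B_plus_eq[OF \<omega>])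
  have sum_eq: "(\<Sum>i\<in>B_plus n A t \<omega>. f i) = (\<Sum>i<m. f (Suc i))" for f :: "nat \<Rightarrow> real"
    unfolding B One_nat_def by (rule sum.atLeast1_atMost_eq)
  have "(\<Sum>i<m. nload n A t \<omega> (Suc i) * probs_plus n A t \<omega> ! i)
      \<le> (\<Sum>i<m. nload n A t \<omega> (Suc i) * replicate m c ! i)"
  proof -
    have "0 \<le> nload n A t \<omega> (Suc i)" if "i < m" for i
    proof -
      from that have "Suc i \<in> B_plus n A t \<omega>" unfolding B by auto
      then show ?thesis by (simp add: B_plus_def)
    qed
    then show ?thesis
      using prefix_dominates_weighted_sum[OF dom, of "\<lambda>i. nload n A t \<omega> (Suc i)"]
        nload_antimono[OF \<omega>] card_B_plus_le[of t \<omega>]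
      by (simp add: m_def)
  qed
  then have "(\<Sum>i<m. nload n A t \<omega> (Suc i) * alloc_prob A t \<omega> (Suc i))
      \<le> (\<Sum>i<m. nload n A t \<omega> (Suc i) * c)"
    by (simp add: probs_plus_def m_def del: upt_Suc)
  then show ?thesis
    using sum_B_plus[of t \<omega>] unfolding sum_eq sum_distrib_right[symmetric]
    by (simp add: mult.commute)
qed

text \<open>Read from the lightest bin upwards, the negated loads are nonnegative and decreasing,
  which is the order in which \<open>probs_minus\<close> lists the probabilities. Negation also
  reverses the inequality, so here the probabilities have to be the dominating vector.\<close>

lemma B_minus_drift_le:
  assumes \<omega>: "\<omega> \<in> space (pspace A)"
    and dom: "prefix_dominates (probs_minus n A t \<omega>) (replicate (card (B_minus n A t \<omega>)) c)"
  shows "(\<Sum>i\<in>B_minus n A t \<omega>. nload n A t \<omega> i * alloc_prob A t \<omega> i)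
       \<le> - c * abs_potential n A t \<omega> / 2"
proof -
  define m where "m = card (B_plus n A t \<omega>)"
  have B: "B_minus n A t \<omega> = {m + 1..n}" unfolding m_def by (rule B_minus_eq[OF \<omega>])
  have mn: "m \<le> n" unfolding m_def by (rule card_B_plus_le)
  \<comment> \<open>Position \<open>i\<close> of the reversed list, counted from zero, holds label
    \<open>n - i\<close>.\<close>
  have sum_eq: "(\<Sum>i\<in>B_minus n A t \<omega>. f i) = (\<Sum>i<n - m. f (n - i))" for f :: "nat \<Rightarrow> real"
    unfolding B
    by (rule sum.reindex_bij_witness[of _ "\<lambda>i. n - i" "\<lambda>i. n - i"]) auto
  have len: "length (probs_minus n A t \<omega>) = n - m"
    by (simp add: probs_minus_def m_def del: upt_Suc)
  have nth: "probs_minus n A t \<omega> ! i = alloc_prob A t \<omega> (n - i)" if "i < n - m" for i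
    using that mn by (simp add: probs_minus_def m_def[symmetric] rev_nth Suc_diff_Suc del: upt_Suc)
  have "(\<Sum>i<n - m. - nload n A t \<omega> (n - i) * replicate (n - m) c ! i)
      \<le> (\<Sum>i<n - m. - nload n A t \<omega> (n - i) * probs_minus n A t \<omega> ! i)"
  proof -
    have "nload n A t \<omega> (n - i) \<le> 0" if "i < n - m" for i
    proof -
      from that have "n - i \<in> B_minus n A t \<omega>" unfolding B by auto
      then show ?thesis using B_minus_neg less_imp_le by blast
    qed
    moreover have "nload n A t \<omega> (n - i) \<le> nload n A t \<omega> (n - j)" if "i \<le> j" "j < n - m" for i j
      using that by (intro nload_antimono[OF \<omega>]) auto
    ultimately show ?thesis
      using prefix_dominates_weighted_sum[OF dom, of "\<lambda>i. - nload n A t \<omega> (n - i)"]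
      by (simp add: len card_B_minus m_def[symmetric])
  qed
  then have "(\<Sum>i<n - m. nload n A t \<omega> (n - i) * alloc_prob A t \<omega> (n - i))
      \<le> (\<Sum>i<n - m. nload n A t \<omega> (n - i) * c)"
    by (simp add: nth sum_negf)
  then show ?thesis
    using sum_B_minus[of t \<omega>] unfolding sum_eq sum_distrib_right[symmetric]
    by (simp add: mult.commute)
qed

section \<open>Measurability with respect to the history\<close>

interpretation prob_space "pspace A"
  using alloc by (simp add: allocation_process_def)

lemma measurable_chosen: "chosen A t \<in> pspace A \<rightarrow>\<^sub>M count_space UNIV"
  using alloc unfolding allocation_process_def
  by (blast intro: measurable_count_space_UNIV)

lemma measurable_balls: "balls A t \<in> pspace A \<rightarrow>\<^sub>M count_space UNIV"
  using alloc unfolding allocation_process_def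
  by (blast intro: measurable_count_space_UNIV)

lemma measurable_relabel:
  "i \<in> {1..n} \<Longrightarrow> (\<lambda>\<omega>. relabel A t \<omega> i) \<in> pspace A \<rightarrow>\<^sub>M count_space UNIV"
  using alloc unfolding allocation_process_def
  by (blast intro: measurable_count_space_UNIV)

abbreviation history :: "nat \<Rightarrow> 'a \<Rightarrow> (nat \<times> nat) list" where
  "history t \<omega> \<equiv> map (\<lambda>s. (chosen A s \<omega>, balls A s \<omega>)) [0..<t]"

lemma measurable_history: "history t \<in> pspace A \<rightarrow>\<^sub>M count_space UNIV"
proof (induction t)
  case (Suc t)
  have "(\<lambda>\<omega>. history t \<omega> @ [(chosen A t \<omega>, balls A t \<omega>)]) \<in> pspace A \<rightarrow>\<^sub>M count_space UNIV"
    using Suc measurable_chosen[of t] measurable_balls[of t] by measurable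
  then show ?case by simp
qed simp

lemma subalgebra_filt: "subalgebra (pspace A) (filt A t)"
  unfolding subalgebra_def filt_def
  using measurable_sets[OF measurable_history[of t]] by (auto simp: sets_vimage_algebra2)

lemma filt_subalgebra: "sigma_finite_subalgebra (pspace A) (filt A t)"
  by (intro finite_measure_subalgebra_is_sigma_finite)
     (simp add: finite_measure_subalgebra_def finite_measure_subalgebra_axioms_def
        subalgebra_filt finite_measure_axioms)

lemma bin_load_eq_history:
  "bin_load A t \<omega> = (\<lambda>j. \<Sum>(k, b)\<leftarrow>history t \<omega>. if k = j then b else 0)"
  by (rule ext) (simp add: bin_load_def comp_def interv_sum_list_conv_sum_set_nat atLeast0LessThan)

text \<open>The label \<open>i\<close> itself need not be determined by the history, but the load it carries is.\<close>

lemma load_eq_history: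
  assumes \<omega>: "\<omega> \<in> space (pspace A)" and i: "i \<in> {1..n}"
  shows "load A t \<omega> i =
    sort (map (\<lambda>j. \<Sum>(k, b)\<leftarrow>history t \<omega>. if k = j then b else 0) [1..<n + 1]) ! (n - i)"
proof -
  \<comment> \<open>\<open>L\<close> lists the loads in ascending order. A relabelling is a
    permutation, so \<open>L\<close> has the same multiset of entries as the physical loads and
    hence is their sorted list; label \<open>i\<close> sits at zero-based position
    \<open>n - i\<close>.\<close>
  define L where "L = rev (map (load A t \<omega>) [1..<n + 1])"
  have "sorted L"
    unfolding L_def sorted_rev_iff_nth_mono
    using monotone_onD[OF load_antimono[OF \<omega>, of t]] by (auto simp del: upt_Suc)
  moreover have "mset L = mset (map (bin_load A t \<omega>) [1..<n + 1])"
  proof -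
    have set: "mset [1..<n + 1] = mset_set {1..n}"
      by (metis Suc_eq_plus1 atLeastLessThanSuc_atLeastAtMost mset_upt)
    have "image_mset (relabel A t \<omega>) (mset_set {1..n}) = mset_set {1..n}"
      using relabel_bij[OF \<omega>, of t] image_mset_mset_set[of "relabel A t \<omega>" "{1..n}"]
      by (simp add: bij_betw_def)
    then show ?thesis
      unfolding L_def mset_rev mset_map set
      by (metis (no_types, lifting) image_mset_cong load_def multiset.map_comp comp_apply)
  qed
  ultimately have "L = sort (map (bin_load A t \<omega>) [1..<n + 1])"
    by (metis properties_for_sort)
  moreover have "L ! (n - i) = load A t \<omega> i"
    using i unfolding L_def by (auto simp: rev_nth simp del: upt_Suc)
  ultimately show ?thesis unfolding bin_load_eq_history by metis
qed

text \<open>The history takes values in a discrete space, so every function of it, in particular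
  sorting and selecting an entry, is measurable.\<close>

lemma load_measurable_filt:
  assumes i: "i \<in> {1..n}"
  shows "(\<lambda>\<omega>. load A t \<omega> i) \<in> filt A t \<rightarrow>\<^sub>M count_space UNIV"
proof -
  define G where "G h =
    sort (map (\<lambda>j. \<Sum>(k, b)\<leftarrow>h. if k = j then b else 0) [1..<n + 1]) ! (n - i)"
    for h :: "(nat \<times> nat) list"
  have "history t \<in> filt A t \<rightarrow>\<^sub>M count_space UNIV"
    unfolding filt_def by (rule measurable_vimage_algebra1) simp
  then have "(\<lambda>\<omega>. G (history t \<omega>)) \<in> filt A t \<rightarrow>\<^sub>M count_space UNIV"
    by (rule measurable_compose) simp
  also have "?this \<longleftrightarrow> ?thesis"
    using load_eq_history[OF _ i, of _ t]
    by (intro measurable_cong) (simp add: filt_def G_def del: upt_Suc)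
  finally show ?thesis .
qed

lemma nload_measurable_filt:
  assumes i: "i \<in> {1..n}"
  shows "(\<lambda>\<omega>. nload n A t \<omega> i) \<in> borel_measurable (filt A t)"
proof -
  have "(\<lambda>\<omega>. real (load A t \<omega> i)) \<in> borel_measurable (filt A t)" if "i \<in> {1..n}" for i
    by (rule measurable_compose[OF load_measurable_filt[OF that]]) simp
  then show ?thesis
    unfolding nload_def total_load_def of_nat_sum
    using i by (intro borel_measurable_diff borel_measurable_divide borel_measurable_sum) auto
qed

lemma quad_potential_measurable_filt: "quad_potential n A t \<in> borel_measurable (filt A t)"
  unfolding quad_potential_def[abs_def]
  by (intro borel_measurable_sum borel_measurable_power nload_measurable_filt)

end

section \<open>The one-step bound on the conditional expectation\<close>

text \<open>The number of balls as a function of the normalized load alone. Unlike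
  \<open>balls A t\<close>, its value at a given label is determined by the history and can leave
  the conditional expectation.\<close>

definition ball_weight :: "nat \<Rightarrow> nat \<Rightarrow> real \<Rightarrow> real" where
  "ball_weight w_plus w_minus y = (if y < 0 then real w_minus else real w_plus)"

lemma borel_measurable_ball_weight [measurable]: "ball_weight w_plus w_minus \<in> borel_measurable borel"
  unfolding ball_weight_def[abs_def] by measurable

text \<open>The linear part of the increment is a sum over labels of a history-measurable factor
  \<open>g i\<close> times the indicator that label \<open>i\<close> is chosen. Conditioning turns
  that indicator into \<open>alloc_prob\<close>, and the quadratic part is bounded by a
  constant.\<close>

lemma quad_potential_cond_exp_le:
  fixes A :: "'a alloc_process"
  assumes n: "n \<ge> 1" and alloc: "allocation_process n A" and w: "w_plus \<le> w_minus"
    and balls: "\<And>t. AE \<omega> in pspace A. \<forall>i\<in>{1..n}. chosen A t \<omega> = relabel A t \<omega> i \<longrightarrow>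
          balls A t \<omega> = (if nload n A t \<omega> i < 0 then w_minus else w_plus)"
  shows "AE \<omega> in pspace A.
     real_cond_exp (pspace A) (filt A t) (quad_potential n A (t + 1)) \<omega>
       \<le> quad_potential n A t \<omega>
         + (\<Sum>i\<in>B_plus n A t \<omega>. 2 * nload n A t \<omega> i * alloc_prob A t \<omega> i * real w_plus)
         + (\<Sum>i\<in>B_minus n A t \<omega>. 2 * nload n A t \<omega> i * alloc_prob A t \<omega> i * real w_minus)
         + 4 * (real w_minus)\<^sup>2"
proof -
  note ctx = n alloc
  let ?M = "pspace A" and ?F = "filt A t"
  interpret prob_space ?M using alloc by (simp add: allocation_process_def)
  interpret sigma_finite_subalgebra ?M ?F by (rule filt_subalgebra[OF ctx])
  have meas_M: "f \<in> borel_measurable (pspace A)" if "f \<in> borel_measurable (filt A s)"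
    for f :: "'a \<Rightarrow> real" and s
    using measurable_from_subalg[OF subalgebra_filt[OF ctx]] that by blast
  define S where "S i = {\<omega>' \<in> space ?M. chosen A t \<omega>' = relabel A t \<omega>' i}" for i
  define g where "g i \<omega> = 2 * nload n A t \<omega> i * ball_weight w_plus w_minus (nload n A t \<omega> i)" for i \<omega>
  have ap: "alloc_prob A t \<omega> i = real_cond_exp ?M ?F (indicat_real (S i)) \<omega>" for \<omega> i
    by (simp add: alloc_prob_def S_def)
  have S [measurable]: "S i \<in> sets ?M" if "i \<in> {1..n}" for i
  proof -
    have "(\<lambda>\<omega>. real (chosen A t \<omega>)) \<in> borel_measurable ?M"
      by (rule measurable_compose[OF measurable_chosen[OF ctx]]) simp
    moreover have "(\<lambda>\<omega>. real (relabel A t \<omega> i)) \<in> borel_measurable ?M"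
      by (rule measurable_compose[OF measurable_relabel[OF ctx that]]) simp
    ultimately have "{\<omega> \<in> space ?M. real (chosen A t \<omega>) = real (relabel A t \<omega> i)} \<in> sets ?M"
      by (rule borel_measurable_eq)
    then show ?thesis by (simp add: S_def)
  qed
  have g_F: "g i \<in> borel_measurable ?F" if "i \<in> {1..n}" for i
  proof -
    note [measurable] = nload_measurable_filt[OF ctx that, of t]
    show ?thesis unfolding g_def by measurable
  qed
  \<comment> \<open>Integrability comes from boundedness: almost surely no allocation exceeds
    \<open>w_minus\<close> balls, so after \<open>s\<close> rounds every normalized load is at most
    \<open>s * w_minus\<close> in absolute value.\<close>
  have balls_le: "AE \<omega> in ?M. balls A s \<omega> \<le> w_minus" for s
    using balls[of s] AE_space
  proof eventually_elim
    case (elim \<omega>)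
    then obtain c where "c \<in> {1..n}" "chosen A s \<omega> = relabel A s \<omega> c"
      using chosen_in[OF ctx, of \<omega> s] relabel_bij[OF ctx, of \<omega> s]
      by (metis bij_betw_iff_bijections)
    with elim w show ?case by auto
  qed
  have total_le: "AE \<omega> in ?M. real (total_load n A s \<omega>) \<le> real s * real w_minus" for s
  proof -
    have "AE \<omega> in ?M. \<forall>r\<in>{..<s}. balls A r \<omega> \<le> w_minus"
      using balls_le by (intro AE_finite_allI) auto
    then show ?thesis using AE_space
    proof eventually_elim
      case (elim \<omega>)
      have "(\<Sum>r<s. balls A r \<omega>) \<le> s * w_minus"
        using sum_bounded_above[of "{..<s}" "\<lambda>r. balls A r \<omega>" w_minus] elim by auto
      then show ?case
        unfolding total_load_eq_balls[OF ctx elim(2)] of_nat_mult[symmetric] of_nat_le_iff .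
    qed
  qed
  have nload_le: "AE \<omega> in ?M. \<bar>nload n A s \<omega> i\<bar> \<le> real s * real w_minus" if "i \<in> {1..n}" for i s
    using total_le[of s]
    by eventually_elim (use abs_nload_le[OF ctx that, of s] in \<open>blast intro: order.trans\<close>)
  have quad_int: "integrable ?M (quad_potential n A s)" for s
    unfolding quad_potential_def[abs_def]
  proof (intro Bochner_Integration.integrable_sum)
    fix i assume i: "i \<in> {1..n}"
    show "integrable ?M (\<lambda>\<omega>. (nload n A s \<omega> i)\<^sup>2)"
    proof (rule integrable_const_bound)
      show "AE \<omega> in ?M. norm ((nload n A s \<omega> i)\<^sup>2) \<le> (real s * real w_minus)\<^sup>2"
        using nload_le[OF i, of s]
        by eventually_elim (metis abs_ge_zero norm_power power_mono real_norm_def)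
      show "(\<lambda>\<omega>. (nload n A s \<omega> i)\<^sup>2) \<in> borel_measurable ?M"
        by (intro meas_M[of _ s] borel_measurable_power nload_measurable_filt[OF ctx i])
    qed
  qed
  have g_int: "integrable ?M (\<lambda>\<omega>. g i \<omega> * indicat_real (S i) \<omega>)" if i: "i \<in> {1..n}" for i
  proof (rule integrable_const_bound)
    show "AE \<omega> in ?M. norm (g i \<omega> * indicat_real (S i) \<omega>)
        \<le> 2 * (real t * real w_minus) * real w_minus"
      using nload_le[OF i, of t]
    proof eventually_elim
      case (elim \<omega>)
      have "\<bar>g i \<omega>\<bar> = 2 * \<bar>nload n A t \<omega> i\<bar> * \<bar>ball_weight w_plus w_minus (nload n A t \<omega> i)\<bar>"
        by (simp add: g_def abs_mult)
      also have "\<dots> \<le> 2 * (real t * real w_minus) * real w_minus"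
        using elim w by (intro mult_mono) (auto simp: ball_weight_def)
      finally show ?case by (auto simp: indicator_def)
    qed
    show "(\<lambda>\<omega>. g i \<omega> * indicat_real (S i) \<omega>) \<in> borel_measurable ?M"
      using meas_M[OF g_F[OF i]] S[OF i] by measurable
  qed
  let ?R = "\<lambda>\<omega>. \<Sum>i\<in>{1..n}. g i \<omega> * indicat_real (S i) \<omega>"
  let ?C = "4 * (real w_minus)\<^sup>2"
  have sum_int: "integrable ?M ?R" using g_int by (rule Bochner_Integration.integrable_sum)
  have step: "AE \<omega> in ?M. quad_potential n A (t + 1) \<omega> \<le> (quad_potential n A t \<omega> + ?R \<omega>) + ?C"
    using balls[of t] balls_le[of t] AE_space
  proof eventually_elim
    case (elim \<omega>)
    obtain c where c: "c \<in> {1..n}" "chosen A t \<omega> = relabel A t \<omega> c"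
      using chosen_in[OF ctx elim(3), of t] relabel_bij[OF ctx elim(3), of t]
      by (metis bij_betw_iff_bijections)
    \<comment> \<open>Exactly one indicator is nonzero, because \<open>relabel\<close> is injective
      on the labels.\<close>
    have "?R \<omega> = (\<Sum>i\<in>{1..n}. if c = i then g c \<omega> else 0)"
    proof (rule sum.cong)
      fix i assume i: "i \<in> {1..n}"
      have "inj_on (relabel A t \<omega>) {1..n}"
        using relabel_bij[OF ctx elim(3), of t] by (simp add: bij_betw_def)
      from inj_on_eq_iff[OF this c(1) i] have "\<omega> \<in> S i \<longleftrightarrow> c = i"
        using elim(3) by (simp add: S_def c(2))
      then show "g i \<omega> * indicat_real (S i) \<omega> = (if c = i then g c \<omega> else 0)" by auto
    qed simp
    also have "\<dots> = g c \<omega>" using c by simp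
    also have "\<dots> = 2 * real (balls A t \<omega>) * nload n A t \<omega> c"
      using elim(1) c by (auto simp: g_def ball_weight_def)
    finally have R: "?R \<omega> = 2 * real (balls A t \<omega>) * nload n A t \<omega> c" .
    have "(real (balls A t \<omega>))\<^sup>2 * (1 - 1 / real n) \<le> (real w_minus)\<^sup>2 * 1"
      using elim(2) n by (intro mult_mono power_mono) auto
    \<comment> \<open>The quadratic term costs only one \<open>(real w_minus)\<^sup>2\<close>; the
      factor 4 in \<open>?C\<close> is slack.\<close>
    also have "\<dots> \<le> ?C" by simp
    finally show ?case
      using quad_potential_Suc[OF ctx elim(3) c] R by simp
  qed
  have "AE \<omega> in ?M. real_cond_exp ?M ?F (quad_potential n A (t + 1)) \<omega>
      \<le> real_cond_exp ?M ?F (\<lambda>\<omega>. (quad_potential n A t \<omega> + ?R \<omega>) + ?C) \<omega>"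
    using step quad_int sum_int by (intro real_cond_exp_mono) auto
  moreover have "AE \<omega> in ?M. real_cond_exp ?M ?F (\<lambda>\<omega>. (quad_potential n A t \<omega> + ?R \<omega>) + ?C) \<omega>
      = real_cond_exp ?M ?F (\<lambda>\<omega>. quad_potential n A t \<omega> + ?R \<omega>) \<omega> + real_cond_exp ?M ?F (\<lambda>_. ?C) \<omega>"
    using quad_int sum_int by (intro real_cond_exp_add) auto
  moreover have "AE \<omega> in ?M. real_cond_exp ?M ?F (\<lambda>_. ?C) \<omega> = ?C"
    by (intro real_cond_exp_F_meas) auto
  moreover have "AE \<omega> in ?M. real_cond_exp ?M ?F (\<lambda>\<omega>. quad_potential n A t \<omega> + ?R \<omega>) \<omega>
      = real_cond_exp ?M ?F (quad_potential n A t) \<omega> + real_cond_exp ?M ?F ?R \<omega>"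
    using quad_int sum_int by (intro real_cond_exp_add) auto
  moreover have "AE \<omega> in ?M. real_cond_exp ?M ?F (quad_potential n A t) \<omega> = quad_potential n A t \<omega>"
    using quad_int quad_potential_measurable_filt[OF ctx] by (intro real_cond_exp_F_meas) auto
  moreover have "AE \<omega> in ?M. real_cond_exp ?M ?F ?R \<omega>
      = (\<Sum>i\<in>{1..n}. real_cond_exp ?M ?F (\<lambda>\<omega>. g i \<omega> * indicat_real (S i) \<omega>) \<omega>)"
  proof -
    \<comment> \<open>The summands are extended by zero outside \<open>{1..n}\<close> because
      \<open>real_cond_exp_sum\<close> asks for integrability at every index.\<close>
    define h where "h i = (if i \<in> {1..n} then \<lambda>\<omega>. g i \<omega> * indicat_real (S i) \<omega> else (\<lambda>_. 0))" for i
    have h: "h i = (\<lambda>\<omega>. g i \<omega> * indicat_real (S i) \<omega>)" if "i \<in> {1..n}" for i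
      unfolding h_def using that by (rule if_P)
    have "integrable ?M (h i)" for i
      by (cases "i \<in> {1..n}") (use g_int in \<open>simp_all add: h_def\<close>)
    then have "AE \<omega> in ?M. real_cond_exp ?M ?F (\<lambda>\<omega>. \<Sum>i\<in>{1..n}. h i \<omega>) \<omega>
        = (\<Sum>i\<in>{1..n}. real_cond_exp ?M ?F (h i) \<omega>)"
      by (rule real_cond_exp_sum)
    moreover have "(\<lambda>\<omega>. \<Sum>i\<in>{1..n}. h i \<omega>) = ?R"
      by (intro ext sum.cong) (simp_all only: h)
    moreover have "(\<Sum>i\<in>{1..n}. real_cond_exp ?M ?F (h i) \<omega>)
        = (\<Sum>i\<in>{1..n}. real_cond_exp ?M ?F (\<lambda>\<omega>. g i \<omega> * indicat_real (S i) \<omega>) \<omega>)" for \<omega>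
      by (intro sum.cong) (simp_all only: h)
    ultimately show ?thesis by (simp only:)
  qed
  \<comment> \<open>Pulling out the known factor \<open>g i\<close>; finitely many labels share one
    exceptional null set.\<close>
  moreover have "AE \<omega> in ?M. \<forall>i\<in>{1..n}.
      real_cond_exp ?M ?F (\<lambda>\<omega>. g i \<omega> * indicat_real (S i) \<omega>) \<omega> = g i \<omega> * alloc_prob A t \<omega> i"
    unfolding ap using g_F g_int S
    by (intro AE_finite_allI real_cond_exp_mult borel_measurable_indicator) simp_all
  ultimately show ?thesis
  proof eventually_elim
    case (elim \<omega>)
    have plus: "(\<Sum>i\<in>B_plus n A t \<omega>. g i \<omega> * alloc_prob A t \<omega> i)
        = (\<Sum>i\<in>B_plus n A t \<omega>. 2 * nload n A t \<omega> i * alloc_prob A t \<omega> i * real w_plus)"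
      by (rule sum.cong) (auto simp: g_def ball_weight_def B_plus_def)
    have minus: "(\<Sum>i\<in>B_minus n A t \<omega>. g i \<omega> * alloc_prob A t \<omega> i)
        = (\<Sum>i\<in>B_minus n A t \<omega>. 2 * nload n A t \<omega> i * alloc_prob A t \<omega> i * real w_minus)"
      by (rule sum.cong) (auto simp: g_def ball_weight_def dest: B_minus_neg[OF ctx])
    have "(\<Sum>i\<in>{1..n}. real_cond_exp ?M ?F (\<lambda>\<omega>. g i \<omega> * indicat_real (S i) \<omega>) \<omega>)
        = (\<Sum>i\<in>{1..n}. g i \<omega> * alloc_prob A t \<omega> i)"
      using elim by (intro sum.cong) auto
    also note sum_split_B[OF ctx, of _ t \<omega>]
    finally show ?case using elim plus minus by linarith
  qed
qed

section \<open>From majorization to a drift proportional to \<open>abs_potential\<close>\<close>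

text \<open>The factor 2 in the drift cancels the half of \<open>abs_potential\<close> on each side,
  so the total is at most \<open>a * w_plus - b * w_minus\<close> times
  \<open>abs_potential\<close>. Thus \<open>gap\<close> is a lower bound on the rate of
  decrease.\<close>

lemma drift_le:
  assumes n: "n \<ge> 1" and alloc: "allocation_process n A" and \<omega>: "\<omega> \<in> space (pspace A)"
    and plus: "prefix_dominates (replicate (card (B_plus n A t \<omega>)) a) (probs_plus n A t \<omega>)"
    and minus: "prefix_dominates (probs_minus n A t \<omega>) (replicate (card (B_minus n A t \<omega>)) b)"
    and gap: "c / real n \<le> b * real w_minus - a * real w_plus"
  shows "(\<Sum>i\<in>B_plus n A t \<omega>. 2 * nload n A t \<omega> i * alloc_prob A t \<omega> i * real w_plus)
       + (\<Sum>i\<in>B_minus n A t \<omega>. 2 * nload n A t \<omega> i * alloc_prob A t \<omega> i * real w_minus)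
       \<le> - (c / real n * abs_potential n A t \<omega>)"
proof -
  let ?D = "abs_potential n A t \<omega>"
  have "(\<Sum>i\<in>B_plus n A t \<omega>. 2 * nload n A t \<omega> i * alloc_prob A t \<omega> i * real w_plus)
      = 2 * real w_plus * (\<Sum>i\<in>B_plus n A t \<omega>. nload n A t \<omega> i * alloc_prob A t \<omega> i)"
    by (simp add: sum_distrib_left mult_ac)
  also have "\<dots> \<le> 2 * real w_plus * (a * ?D / 2)"
    by (intro mult_left_mono B_plus_drift_le[OF n alloc \<omega> plus]) simp
  finally have 1: "(\<Sum>i\<in>B_plus n A t \<omega>. 2 * nload n A t \<omega> i * alloc_prob A t \<omega> i * real w_plus)
    \<le> a * real w_plus * ?D" by (simp add: mult_ac)
  have "(\<Sum>i\<in>B_minus n A t \<omega>. 2 * nload n A t \<omega> i * alloc_prob A t \<omega> i * real w_minus)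
      = 2 * real w_minus * (\<Sum>i\<in>B_minus n A t \<omega>. nload n A t \<omega> i * alloc_prob A t \<omega> i)"
    by (simp add: sum_distrib_left mult_ac)
  also have "\<dots> \<le> 2 * real w_minus * (- b * ?D / 2)"
    by (intro mult_left_mono B_minus_drift_le[OF n alloc \<omega> minus]) simp
  finally have 2: "(\<Sum>i\<in>B_minus n A t \<omega>. 2 * nload n A t \<omega> i * alloc_prob A t \<omega> i * real w_minus)
    \<le> - (b * real w_minus * ?D)" by (simp add: mult_ac)
  have "c / real n * ?D \<le> (b * real w_minus - a * real w_plus) * ?D"
    by (intro mult_right_mono gap) (simp add: abs_potential_def sum_nonneg)
  with 1 2 show ?thesis by (simp add: left_diff_distrib)
qed

text \<open>The two biases enter with weights \<open>1 - \<delta>\<close> and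
  \<open>\<delta>\<close>, so their convex combination is at least \<open>min k3 k4\<close> whatever
  \<open>\<delta>\<close> is. Multiplying by \<open>wp\<close> and \<open>wm\<close>, both at least
  1, preserves this, and the remaining \<open>wm - wp\<close> is nonnegative.\<close>

lemma P2_gap:
  fixes k3 k4 \<delta> wp wm :: real
  assumes "0 < k3" "0 < k4" "0 \<le> \<delta>" "\<delta> \<le> 1" "1 \<le> wp" "wp \<le> wm" "0 < N"
  shows "min k3 k4 / N \<le> (1 / N + k4 * \<delta> / N) * wm - (1 / N - k3 * (1 - \<delta>) / N) * wp"
proof -
  have "min k3 k4 = min k3 k4 * (1 - \<delta>) + min k3 k4 * \<delta>" by (simp add: algebra_simps)
  also have "\<dots> \<le> k3 * (1 - \<delta>) + k4 * \<delta>"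
    using assms by (intro add_mono mult_right_mono) auto
  also have "\<dots> \<le> k3 * (1 - \<delta>) * wp + k4 * \<delta> * wm"
    using assms mult_left_mono[of 1 wp "k3 * (1 - \<delta>)"] mult_left_mono[of 1 wm "k4 * \<delta>"]
    by (intro add_mono) auto
  also have "\<dots> \<le> (1 + k4 * \<delta>) * wm - (1 - k3 * (1 - \<delta>)) * wp"
    using assms by (simp add: algebra_simps)
  finally have "min k3 k4 / N \<le> ((1 + k4 * \<delta>) * wm - (1 - k3 * (1 - \<delta>)) * wp) / N"
    using assms by (intro divide_right_mono) auto
  also have "\<dots> = (1 / N + k4 * \<delta> / N) * wm - (1 / N - k3 * (1 - \<delta>) / N) * wp"
    using assms by (simp add: field_simps)
  finally show ?thesis .
qed

section \<open>The two drift inequalities for families of processes\<close>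

theorem lemma6p2:
  fixes A :: "nat \<Rightarrow> 'a alloc_process" and w_plus w_minus :: nat
  assumes "\<And>n. n \<ge> 1 \<Longrightarrow> allocation_process n (A n)"
  shows "(cond_P1 A \<and> cond_W1 w_plus w_minus A \<longrightarrow>
            (\<forall>n\<ge>1. \<forall>t. AE \<omega> in pspace (A n).
               real_cond_exp (pspace (A n)) (filt (A n) t) (quad_potential n (A n) (t + 1)) \<omega>
               \<le> quad_potential n (A n) t \<omega>
                 + (\<Sum>i\<in>B_plus n (A n) t \<omega>.
                      2 * nload n (A n) t \<omega> i * alloc_prob (A n) t \<omega> i * real w_plus)
                 + (\<Sum>i\<in>B_minus n (A n) t \<omega>.
                      2 * nload n (A n) t \<omega> i * alloc_prob (A n) t \<omega> i * real w_minus)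
                 + 4 * (real w_minus)\<^sup>2)) \<and>
         ((cond_P2 A \<and> cond_W1 w_plus w_minus A) \<or> (cond_P1 A \<and> cond_W2 w_plus w_minus A) \<longrightarrow>
            (\<exists>c1>0. \<exists>c2>0. \<forall>n\<ge>1. \<forall>t. AE \<omega> in pspace (A n).
               real_cond_exp (pspace (A n)) (filt (A n) t) (quad_potential n (A n) (t + 1)) \<omega>
               \<le> quad_potential n (A n) t \<omega> - c1 / real n * abs_potential n (A n) t \<omega> + c2))"
    (is "(?hyp1 \<longrightarrow> ?first) \<and> (?hyp2 \<longrightarrow> ?second)")
proof -
  have first: "AE \<omega> in pspace (A n).
      real_cond_exp (pspace (A n)) (filt (A n) t) (quad_potential n (A n) (t + 1)) \<omega>
      \<le> quad_potential n (A n) t \<omega>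
        + (\<Sum>i\<in>B_plus n (A n) t \<omega>.
             2 * nload n (A n) t \<omega> i * alloc_prob (A n) t \<omega> i * real w_plus)
        + (\<Sum>i\<in>B_minus n (A n) t \<omega>.
             2 * nload n (A n) t \<omega> i * alloc_prob (A n) t \<omega> i * real w_minus)
        + 4 * (real w_minus)\<^sup>2"
    if "cond_W1 w_plus w_minus A" "n \<ge> 1" for n t
    using that assms by (intro quad_potential_cond_exp_le) (auto simp: cond_W1_def)
  then have ?first if ?hyp1 using that by blast
  moreover have ?second if ?hyp2
  proof -
    have W1: "cond_W1 w_plus w_minus A" using that by (auto simp: cond_W2_def)
    then have w: "1 \<le> w_plus" "w_plus \<le> w_minus" by (auto simp: cond_W1_def)
    \<comment> \<open>A common form for both alternatives. The levels \<open>a\<close> and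
      \<open>b\<close> may vary with the outcome, since under \<open>cond_P2\<close> they involve
      \<open>quant\<close>, but \<open>c\<close> is uniform in \<open>n\<close> and
      \<open>t\<close>.\<close>
    have "\<exists>c>0. \<forall>n\<ge>1. \<forall>t. AE \<omega> in pspace (A n). \<exists>a b.
        prefix_dominates (replicate (card (B_plus n (A n) t \<omega>)) a) (probs_plus n (A n) t \<omega>) \<and>
        prefix_dominates (probs_minus n (A n) t \<omega>) (replicate (card (B_minus n (A n) t \<omega>)) b) \<and>
        c / real n \<le> b * real w_minus - a * real w_plus"
      using that
    proof
      assume "cond_P2 A \<and> cond_W1 w_plus w_minus A"
      then obtain k3 k4 where k: "0 < k3" "0 < k4" and P2: "\<And>n t. n \<ge> 1 \<Longrightarrow>
        AE \<omega> in pspace (A n).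
          prefix_dominates (replicate (card (B_plus n (A n) t \<omega>))
             (1 / real n - k3 * (1 - quant n (A n) t \<omega>) / real n)) (probs_plus n (A n) t \<omega>) \<and>
          prefix_dominates (probs_minus n (A n) t \<omega>) (replicate (card (B_minus n (A n) t \<omega>))
             (1 / real n + k4 * quant n (A n) t \<omega> / real n))"
        unfolding cond_P2_def by (fastforce elim: eventually_mono)
      show ?thesis
      proof (intro exI[of _ "min k3 k4"] conjI allI impI)
        fix n :: nat and t assume n: "n \<ge> 1"
        have \<delta>: "0 \<le> quant n (A n) t \<omega>" "quant n (A n) t \<omega> \<le> 1" for \<omega>
          using n card_B_plus_le[OF n assms[OF n], of t \<omega>] by (auto simp: quant_def divide_le_eq)
        have gap: "min k3 k4 / real n
            \<le> (1 / real n + k4 * quant n (A n) t \<omega> / real n) * real w_minus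
              - (1 / real n - k3 * (1 - quant n (A n) t \<omega>) / real n) * real w_plus" for \<omega>
          using k \<delta> w n by (intro P2_gap) auto
        show "AE \<omega> in pspace (A n). \<exists>a b.
          prefix_dominates (replicate (card (B_plus n (A n) t \<omega>)) a) (probs_plus n (A n) t \<omega>) \<and>
          prefix_dominates (probs_minus n (A n) t \<omega>) (replicate (card (B_minus n (A n) t \<omega>)) b) \<and>
          min k3 k4 / real n \<le> b * real w_minus - a * real w_plus"
          using P2[OF n, of t] by eventually_elim (use gap in blast)
      qed (use k in simp)
    next
      assume H: "cond_P1 A \<and> cond_W2 w_plus w_minus A"
      then have P1: "\<And>n t. n \<ge> 1 \<Longrightarrow> AE \<omega> in pspace (A n).
          prefix_dominates (replicate (card (B_plus n (A n) t \<omega>)) (1 / real n))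
            (probs_plus n (A n) t \<omega>) \<and>
          prefix_dominates (probs_minus n (A n) t \<omega>)
            (replicate (card (B_minus n (A n) t \<omega>)) (1 / real n))"
        unfolding cond_P1_def by (fastforce elim: eventually_mono)
      show ?thesis
      proof (intro exI[of _ 1] conjI allI impI)
        fix n :: nat and t assume n: "n \<ge> 1"
        \<comment> \<open>The weights are integers, so strict inequality means a difference of at
          least 1; with \<open>a = b = 1 / n\<close> this allows \<open>c = 1\<close>.\<close>
        have "w_plus + 1 \<le> w_minus" using H by (simp add: cond_W2_def)
        then have gap: "1 / real n \<le> 1 / real n * real w_minus - 1 / real n * real w_plus"
          using n by (simp add: field_simps)
        show "AE \<omega> in pspace (A n). \<exists>a b.
          prefix_dominates (replicate (card (B_plus n (A n) t \<omega>)) a) (probs_plus n (A n) t \<omega>) \<and>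
          prefix_dominates (probs_minus n (A n) t \<omega>) (replicate (card (B_minus n (A n) t \<omega>)) b) \<and>
          1 / real n \<le> b * real w_minus - a * real w_plus"
          using P1[OF n, of t] by eventually_elim (use gap in blast)
      qed simp
    qed
    then obtain c where c: "c > 0" "\<And>n t. n \<ge> 1 \<Longrightarrow> AE \<omega> in pspace (A n). \<exists>a b.
        prefix_dominates (replicate (card (B_plus n (A n) t \<omega>)) a) (probs_plus n (A n) t \<omega>) \<and>
        prefix_dominates (probs_minus n (A n) t \<omega>) (replicate (card (B_minus n (A n) t \<omega>)) b) \<and>
        c / real n \<le> b * real w_minus - a * real w_plus"
      by blast
    show ?second
    \<comment> \<open>The additive constant is the one of the first bound, positive because
      \<open>w_minus\<close> is at least 1.\<close>
    proof (rule exI[of _ c], rule conjI[OF c(1)], rule exI[of _ "4 * (real w_minus)\<^sup>2"],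
        intro conjI allI impI)
      fix n :: nat and t assume n: "n \<ge> 1"
      show "AE \<omega> in pspace (A n).
          real_cond_exp (pspace (A n)) (filt (A n) t) (quad_potential n (A n) (t + 1)) \<omega>
          \<le> quad_potential n (A n) t \<omega> - c / real n * abs_potential n (A n) t \<omega>
            + 4 * (real w_minus)\<^sup>2"
        using first[OF W1 n, of t] c(2)[OF n, of t] AE_space
      proof eventually_elim
        case (elim \<omega>)
        then obtain a b where
          "prefix_dominates (replicate (card (B_plus n (A n) t \<omega>)) a) (probs_plus n (A n) t \<omega>)"
          "prefix_dominates (probs_minus n (A n) t \<omega>) (replicate (card (B_minus n (A n) t \<omega>)) b)"
          "c / real n \<le> b * real w_minus - a * real w_plus"
          by blast
        from drift_le[OF n assms[OF n] elim(3) this] elim(1) show ?case by linarith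
      qed
    qed (use w in simp)
  qed
  ultimately show ?thesis by blast
qed

end
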